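(* Let $n\in\mathbb{N}$, let $\mathcal{L}\subset\mathbb{R}$ be a finite set of labels, let $\mathcal{F}:\mathbb{B}_n\to\mathbb{R}$ be a map (the classification map), and let $(\boldsymbol{x},l)$ be a random pair with values in $\mathbb{B}_n\times\mathcal{L}$ whose distribution has probability density function $p:\mathbb{B}_n\times\mathcal{L}\to\mathbb{R}_{\ge 0}$. Suppose there exist a label $A\in\mathcal{L}$ with $P(A)>0$, a measurable set $\mathcal{C}_A\subset\mathbb{B}_n$, a number $r_A\in(0,1)$, a vector $\boldsymbol{x}_A\in\mathbb{B}_n$, a constant $C>0$, a number $\nu\in(0,1]$ and a number $\Delta>0$ such that: (A1) $\mathcal{C}_A\subset\mathbb{B}_n(r_A,\boldsymbol{x}_A)$; (A2) $\mathcal{F}(\boldsymbol{x})=A$ for all $\boldsymbol{x}\in\mathcal{C}_A$, and for every $\boldsymbol{x}\in\mathbb{S}_{n-1}(r_A,\boldsymbol{x}_A)$ there exists $\boldsymbol{y}(\boldsymbol{x})\in\mathbb{B}_n$ with $\mathcal{F}(\boldsymbol{y}(\boldsymbol{x}))\neq A$ and $\|\boldsymbol{y}(\boldsymbol{x})-\boldsymbol{x}\|\le\Delta$; (A3) the conditional density $p_A$ (extended by $0$ outside $\mathbb{B}_n$) satisfies $$p_A(\boldsymbol{x})\le\frac{C}{V_n(\mathbb{B}_n)}\frac{1}{r_A^n}\quad\text{for all }\boldsymbol{x}\in\mathbb{B}_n(r_A,\boldsymbol{x}_A),\qquad\text{and}\qquad\int_{\mathcal{C}_A}p_A(\boldsymbol{x})\,d\boldsymbol{x}\ge\nu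 .$$ Then for every $\varepsilon\in(0,r_A)$, the probability that $\boldsymbol{x}$ admits an $(\varepsilon+\Delta)$-adversarial example is at least $$P(A)\max\left\{\nu-C\left(1-\frac{\varepsilon}{r_A}\right)^n,\,0\right\}.$$
   Context: $\|\cdot\|$ is the Euclidean norm on $\mathbb{R}^n$; $\mathbb{B}_n=\{\boldsymbol{x}\in\mathbb{R}^n:\|\boldsymbol{x}\|\le1\}$; $\mathbb{B}_n(r,\boldsymbol{y})=\{\boldsymbol{x}\in\mathbb{R}^n:\|\boldsymbol{x}-\boldsymbol{y}\|\le r\}$; $\mathbb{S}_{n-1}(r,\boldsymbol{y})=\{\boldsymbol{x}\in\mathbb{R}^n:\|\boldsymbol{x}-\boldsymbol{y}\|=r\}$ (neither the ball $\mathbb{B}_n(r_A,\boldsymbol{x}_A)$ nor the sphere is required to lie in $\mathbb{B}_n$). $V_n$ is $n$-dimensional Lebesgue measure. The density $p$ is taken with respect to (Lebesgue measure on $\mathbb{B}_n$) $\times$ (counting measure on $\mathcal{L}$). For a label $A$: $P(A)=\int_{\mathbb{B}_n}p(\boldsymbol{x},A)\,d\boldsymbol{x}$ is the probability that $l=A$, and $p_A(\boldsymbol{x})=p(\boldsymbol{x}\mid l=A)=p(\boldsymbol{x},A)/P(A)$. Definition. For $\delta>0$, an element $\boldsymbol{x}\in\mathbb{B}_n$ admits a $\delta$-adversarial example (for $\mathcal{F}$) if there exists $\boldsymbol{y}\in\mathbb{B}_n$ with $\mathcal{F}(\boldsymbol{x})\neq\mathcal{F}(\boldsymbol{y})$ and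 $\|\boldsymbol{x}-\boldsymbol{y}\|\le\delta$. Convention: no measurability of $\mathcal{F}$ is assumed; "the probability that an event occurs is at least $q$" means that the event contains a measurable event of probability at least $q$ (for a measurable event this is the usual meaning). *)

theory Defs
  imports "HOL-Probability.Probability"
begin

abbreviation unit_ball :: "(real ^ 'n) set" where
  "unit_ball \<equiv> cball 0 1"

text \<open>
  The random pair is Borel measurable, as usual for random vectors, while the density need only
  be Lebesgue measurable. The constant \<^const>\<open>distributed\<close> uses one \<open>\<sigma>\<close>-algebra
  for both purposes; two lemmas below show that it implies \<open>has_pair_density\<close> for
  either choice of that \<open>\<sigma>\<close>-algebra.
\<close>

definition has_pair_density ::
  "'w measure \<Rightarrow> real set \<Rightarrow> ('w \<Rightarrow> real ^ 'n) \<Rightarrow> ('w \<Rightarrow> real) \<Rightarrow> ((real ^ 'n) \<times> real \<Rightarrow> real) \<Rightarrow> bool"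
where
  "has_pair_density M Labels X l p \<longleftrightarrow>
     (\<lambda>\<omega>. (X \<omega>, l \<omega>)) \<in> M \<rightarrow>\<^sub>M restrict_space borel unit_ball \<Otimes>\<^sub>M count_space Labels \<and>
     p \<in> borel_measurable (lebesgue_on unit_ball \<Otimes>\<^sub>M count_space Labels) \<and>
     (\<forall>z \<in> unit_ball \<times> Labels. 0 \<le> p z) \<and>
     (\<forall>E \<in> sets (restrict_space borel unit_ball \<Otimes>\<^sub>M count_space Labels).
        emeasure M {\<omega> \<in> space M. (X \<omega>, l \<omega>) \<in> E} =
        (\<integral>\<^sup>+ z \<in> E. ennreal (p z) \<partial>(lebesgue_on unit_ball \<Otimes>\<^sub>M count_space Labels)))"

definition label_prob :: "((real ^ 'n) \<times> real \<Rightarrow> real) \<Rightarrow> real \<Rightarrow> real" where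
  "label_prob p A = (LINT x:unit_ball|lebesgue. p (x, A))"

definition cond_density :: "((real ^ 'n) \<times> real \<Rightarrow> real) \<Rightarrow> real \<Rightarrow> real ^ 'n \<Rightarrow> real" where
  "cond_density p A x = (if x \<in> unit_ball then p (x, A) / label_prob p A else 0)"

definition admits_adversarial :: "(real ^ 'n \<Rightarrow> real) \<Rightarrow> real \<Rightarrow> real ^ 'n \<Rightarrow> bool" where
  "admits_adversarial F \<delta> x \<longleftrightarrow> (\<exists>y \<in> unit_ball. F x \<noteq> F y \<and> norm (x - y) \<le> \<delta>)"

text \<open>
  The event \<open>S\<close> need not be measurable. In a probability space, for measurable \<open>S\<close>, it says \<open>q \<le> measure M S\<close>.
\<close>

definition prob_at_least :: "'w measure \<Rightarrow> 'w set \<Rightarrow> real \<Rightarrow> bool" where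
  "prob_at_least M S q \<longleftrightarrow> (\<exists>E \<in> sets M. E \<subseteq> S \<and> q \<le> measure M E)"

lemma (in finite_measure) prob_at_least_sets:
  assumes "S \<in> sets M"
  shows "prob_at_least M S q \<longleftrightarrow> q \<le> measure M S"
  unfolding prob_at_least_def
  using assms by (meson finite_measure_mono order_refl order_trans)

lemma has_pair_density_if_distributed_lebesgue:
  fixes X :: "'w \<Rightarrow> real ^ 'n"
  assumes d: "distributed M (lebesgue_on unit_ball \<Otimes>\<^sub>M count_space Labels) (\<lambda>\<omega>. (X \<omega>, l \<omega>))
                (\<lambda>z. ennreal (p z))"
    and nonneg: "\<forall>z \<in> unit_ball \<times> Labels. 0 \<le> p z"
  shows "has_pair_density M Labels X l p"
proof -
  let ?N = "lebesgue_on unit_ball \<Otimes>\<^sub>M count_space Labels :: ((real ^ 'n) \<times> real) measure"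
  let ?B = "restrict_space borel unit_ball \<Otimes>\<^sub>M count_space Labels :: ((real ^ 'n) \<times> real) measure"
  have id: "(\<lambda>x. x) \<in> lebesgue_on (unit_ball :: (real ^ 'n) set) \<rightarrow>\<^sub>M restrict_space borel unit_ball"
    by (intro measurable_restrict_space3 measurable_completion) auto
  have idN: "(\<lambda>z. z) \<in> ?N \<rightarrow>\<^sub>M ?B"
    using measurable_Pair[OF measurable_compose[OF measurable_fst id] measurable_snd] by simp
  have sets: "E \<in> sets ?N" if "E \<in> sets ?B" for E
  proof -
    have "E \<subseteq> space ?N"
      using sets.sets_into_space[OF that] by (simp add: space_pair_measure space_restrict_space)
    then have "(\<lambda>z. z) -` E \<inter> space ?N = E" by auto
    then show ?thesis using measurable_sets[OF idN that] by simp
  qed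
  have X: "(\<lambda>\<omega>. (X \<omega>, l \<omega>)) \<in> M \<rightarrow>\<^sub>M ?N"
    using d by (rule distributed_measurable)
  have "(\<lambda>z. enn2real (ennreal (p z))) \<in> borel_measurable ?N"
    using distributed_borel_measurable[OF d] by measurable
  then have p: "p \<in> borel_measurable ?N"
    by (subst measurable_cong[where g = "\<lambda>z. enn2real (ennreal (p z))"])
      (use nonneg in \<open>auto simp: space_pair_measure space_restrict_space\<close>)
  have "emeasure M {\<omega> \<in> space M. (X \<omega>, l \<omega>) \<in> E} = (\<integral>\<^sup>+ z \<in> E. ennreal (p z) \<partial>?N)"
    if "E \<in> sets ?B" for E
    using distributed_emeasure[OF d sets[OF that]] by (simp add: vimage_def Int_def conj_commute)
  then show ?thesis
    using measurable_compose[OF X idN] p nonneg unfolding has_pair_density_def by simp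
qed

lemma has_pair_density_if_distributed_lborel:
  fixes X :: "'w \<Rightarrow> real ^ 'n"
  assumes d: "distributed M (restrict_space lborel unit_ball \<Otimes>\<^sub>M count_space Labels)
                (\<lambda>\<omega>. (X \<omega>, l \<omega>)) (\<lambda>z. ennreal (p z))"
    and nonneg: "\<forall>z \<in> unit_ball \<times> Labels. 0 \<le> p z"
    and fin: "finite Labels"
  shows "has_pair_density M Labels X l p"
proof -
  let ?L = "lebesgue_on unit_ball :: (real ^ 'n) measure"
  let ?R = "restrict_space lborel unit_ball :: (real ^ 'n) measure"
  let ?C = "count_space Labels :: real measure"
  have id: "(\<lambda>x. x) \<in> ?L \<rightarrow>\<^sub>M ?R"
    by (intro measurable_restrict_space3 measurable_completion) auto
  have "distr ?L ?R (\<lambda>x. x) = ?R"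
  proof (rule measure_eqI)
    fix A assume "A \<in> sets (distr ?L ?R (\<lambda>x. x))"
    then have A: "A \<in> sets ?R" by simp
    then have "A \<subseteq> unit_ball" "A \<in> sets borel" by (auto simp: sets_restrict_space)
    moreover from this have "(\<lambda>x. x) -` A \<inter> space ?L = A" by (auto simp: space_restrict_space)
    ultimately show "emeasure (distr ?L ?R (\<lambda>x. x)) A = emeasure ?R A"
      using emeasure_distr[OF id A] by (simp add: emeasure_restrict_space)
  qed simp
  moreover have "sigma_finite_measure (distr ?C ?C (\<lambda>x. x))"
    using fin by (simp add: distr_id2 sigma_finite_measure_count_space_finite)
  ultimately have eq: "distr (?L \<Otimes>\<^sub>M ?C) (?R \<Otimes>\<^sub>M ?C) (\<lambda>z. z) = ?R \<Otimes>\<^sub>M ?C"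
    using pair_measure_distr[OF id, of "\<lambda>x. x" ?C ?C, symmetric] by (simp add: distr_id2 id_def)
  have idN: "(\<lambda>z. z) \<in> ?L \<Otimes>\<^sub>M ?C \<rightarrow>\<^sub>M ?R \<Otimes>\<^sub>M ?C"
    using measurable_Pair[OF measurable_compose[OF measurable_fst id] measurable_snd] by simp
  have sets: "sets (restrict_space borel unit_ball \<Otimes>\<^sub>M ?C) = sets (?R \<Otimes>\<^sub>M ?C)"
    by (intro sets_pair_measure_cong) (simp_all add: sets_restrict_space)
  have X: "(\<lambda>\<omega>. (X \<omega>, l \<omega>)) \<in> M \<rightarrow>\<^sub>M restrict_space borel unit_ball \<Otimes>\<^sub>M ?C"
    unfolding measurable_cong_sets[OF refl sets] using d by (rule distributed_measurable)
  have q: "(\<lambda>z. ennreal (p z)) \<in> borel_measurable (?R \<Otimes>\<^sub>M ?C)"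
    using d by (rule distributed_borel_measurable)
  then have "(\<lambda>z. ennreal (p z)) \<in> borel_measurable (?L \<Otimes>\<^sub>M ?C)"
    by (rule measurable_compose[OF idN])
  then have "(\<lambda>z. enn2real (ennreal (p z))) \<in> borel_measurable (?L \<Otimes>\<^sub>M ?C)"
    by measurable
  then have p: "p \<in> borel_measurable (?L \<Otimes>\<^sub>M ?C)"
    by (subst measurable_cong[where g = "\<lambda>z. enn2real (ennreal (p z))"])
      (use nonneg in \<open>auto simp: space_pair_measure space_restrict_space\<close>)
  have "emeasure M {\<omega> \<in> space M. (X \<omega>, l \<omega>) \<in> E} = (\<integral>\<^sup>+ z \<in> E. ennreal (p z) \<partial>(?L \<Otimes>\<^sub>M ?C))"
    if "E \<in> sets (?R \<Otimes>\<^sub>M ?C)" for E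
  proof -
    have m: "(\<lambda>z. ennreal (p z) * indicator E z) \<in> borel_measurable (?R \<Otimes>\<^sub>M ?C)"
      using q that by measurable
    have "(\<integral>\<^sup>+ z \<in> E. ennreal (p z) \<partial>(?R \<Otimes>\<^sub>M ?C)) = (\<integral>\<^sup>+ z \<in> E. ennreal (p z) \<partial>(?L \<Otimes>\<^sub>M ?C))"
      using nn_integral_distr[OF idN, of "\<lambda>z. ennreal (p z) * indicator E z"] m by (simp add: eq)
    then show ?thesis
      using distributed_emeasure[OF d that] by (simp add: vimage_def Int_def conj_commute)
  qed
  then show ?thesis
    using X p nonneg sets unfolding has_pair_density_def by simp
qed

end

theory Submission
  imports Defs
begin

text \<open>
  A point of \<open>C\<^sub>A\<close> at distance at least \<open>r\<^sub>A - \<epsilon>\<close> from \<open>x\<^sub>A\<close> lies within \<open>\<epsilon>\<close> of its radial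
  projection to the sphere, hence within \<open>\<epsilon> + \<Delta>\<close> of a point not classified as \<open>A\<close>. The rest of
  \<open>C\<^sub>A\<close> lies in a ball of radius \<open>r\<^sub>A - \<epsilon>\<close>, whose conditional probability is at most
  \<open>C (1 - \<epsilon> / r\<^sub>A)\<^sup>n\<close> by the density bound.
\<close>

text \<open>The nearest sphere point lies on the ray from \<open>a\<close> through \<open>x\<close>,
  at distance \<open>r - dist a x\<close> from \<open>x\<close>. The centre has no such ray and is
  treated separately.\<close>

lemma sphere_point_near:
  fixes a x :: "'a :: euclidean_space"
  assumes "dist a x \<le> r" and "r - e \<le> dist a x" and "0 \<le> r" and "0 \<le> e"
  shows "\<exists>s \<in> sphere a r. dist x s \<le> e"
proof (cases "x = a")
  case True
  \<comment> \<open>At the centre the second hypothesis reads \<open>r \<le> e\<close>, so every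
    point of the sphere will do.\<close>
  obtain u :: 'a where "norm u = r"
    using \<open>0 \<le> r\<close> vector_choose_size by blast
  then have "a + u \<in> sphere a r" "dist x (a + u) \<le> e"
    using True assms by (auto simp: dist_norm)
  then show ?thesis by blast
next
  case False
  define d where "d = norm (x - a)"
  define s where "s = a + (r / d) *\<^sub>R (x - a)"
  have d: "0 < d" "d \<le> r" "r - e \<le> d"
    using False assms by (simp_all add: d_def dist_norm norm_minus_commute)
  have "s - x = (r / d - 1) *\<^sub>R (x - a)"
    by (simp add: s_def algebra_simps)
  then have "norm (s - x) = \<bar>r / d - 1\<bar> * d"
    by (simp add: d_def)
  \<comment> \<open>Since \<open>d \<le> r\<close>, the quantity inside the absolute value is
    nonnegative.\<close>
  also have "\<dots> = r - d"
    using d by (simp add: field_simps)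
  finally have "dist x s \<le> e"
    using d by (simp add: dist_norm norm_minus_commute)
  moreover have "norm (s - a) = r"
    using d \<open>0 \<le> r\<close> by (simp add: s_def flip: d_def)
  then have "s \<in> sphere a r"
    by (simp add: dist_norm norm_minus_commute)
  ultimately show ?thesis by blast
qed

text \<open>The random vector is only Borel measurable, so the preimage of a Lebesgue set need not
  be an event. A Borel subset differing by a null set gives an event without changing integrals, and
  taking it inside \<open>D\<close> preserves every pointwise property of \<open>D\<close>.\<close>

lemma borel_subset_lebesgue:
  fixes D :: "'a :: euclidean_space set"
  assumes "D \<in> sets lebesgue"
  obtains B where "B \<in> sets borel" and "B \<subseteq> D" and "AE x in lebesgue. x \<in> B \<longleftrightarrow> x \<in> D"
proof -
  obtain B N N' where B: "D = B \<union> N" "N \<subseteq> N'" "N' \<in> null_sets lborel" "B \<in> sets lborel"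
    using assms by (rule sets_completionE)
  then have "N' \<in> null_sets lebesgue"
    using null_sets_completionI by blast
  then have "AE x in lebesgue. x \<notin> N'"
    by (rule AE_not_in)
  then have "AE x in lebesgue. x \<in> B \<longleftrightarrow> x \<in> D"
    by (rule eventually_mono) (use B in auto)
  with that[of B] B show ?thesis by auto
qed

lemma set_integral_le_const_measure:
  fixes g :: "'a \<Rightarrow> real"
  assumes "set_integrable M B g" and "B \<in> fmeasurable M" and "\<And>x. x \<in> B \<Longrightarrow> g x \<le> K"
  shows "(LINT x:B|M. g x) \<le> K * measure M B"
proof -
  have "set_integrable M B (\<lambda>_. K)"
    using assms(2) by (auto simp: set_integrable_def fmeasurable_def)
  then have "(LINT x:B|M. g x) \<le> (LINT x:B|M. K)"
    using assms by (intro set_integral_mono) auto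
  also have "\<dots> = K * measure M B"
    using assms(2) by (subst set_integral_const) (auto simp: fmeasurable_def)
  finally show ?thesis .
qed

lemma measurable_density_slice:
  assumes "has_pair_density M Labels X l p" and "A \<in> Labels"
  shows "(\<lambda>x. p (x, A)) \<in> borel_measurable (lebesgue_on unit_ball)"
proof -
  have "(\<lambda>x. (x, A)) \<in> lebesgue_on unit_ball \<rightarrow>\<^sub>M lebesgue_on unit_ball \<Otimes>\<^sub>M count_space Labels"
    using assms(2) by (intro measurable_Pair) auto
  then show ?thesis
    using assms(1) measurable_compose unfolding has_pair_density_def by blast
qed

lemma measurable_cond_density:
  assumes "has_pair_density M Labels X l p" and "A \<in> Labels"
  shows "cond_density p A \<in> borel_measurable lebesgue"
proof -
  have "(\<lambda>x. p (x, A) / label_prob p A) \<in> borel_measurable (lebesgue_on unit_ball)"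
    using measurable_density_slice[OF assms] by measurable
  then have "(\<lambda>x. if x \<in> unit_ball then p (x, A) / label_prob p A else 0) \<in> borel_measurable lebesgue"
    by (subst borel_measurable_if) auto
  then show ?thesis
    by (subst measurable_cong) (auto simp: cond_density_def)
qed

text \<open>Tonelli reduces the integral over \<open>B \<times> {A}\<close> to the slice of
  \<open>p\<close> at the label \<open>A\<close>, and on \<open>B\<close> this slice is
  \<open>label_prob p A\<close> times the conditional density.\<close>

lemma measure_label_event:
  fixes X :: "'w \<Rightarrow> real ^ 'n"
  assumes dens: "has_pair_density M Labels X l p" and fin: "finite Labels" and A: "A \<in> Labels"
    and pos: "label_prob p A > 0"
    and B: "B \<in> sets borel" "B \<subseteq> unit_ball"
    and int: "set_integrable lebesgue B (cond_density p A)"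
  shows "{\<omega> \<in> space M. X \<omega> \<in> B \<and> l \<omega> = A} \<in> sets M"
    and "measure M {\<omega> \<in> space M. X \<omega> \<in> B \<and> l \<omega> = A}
           = label_prob p A * (LINT x:B|lebesgue. cond_density p A x)"
proof -
  let ?L = "lebesgue_on unit_ball :: (real ^ 'n) measure"
  let ?C = "count_space Labels :: real measure"
  let ?R = "restrict_space borel unit_ball \<Otimes>\<^sub>M ?C :: ((real ^ 'n) \<times> real) measure"
  let ?P = "label_prob p A" and ?g = "cond_density p A"
  have rect: "B \<times> {A} \<in> sets ?R"
    using B A by (intro pair_measureI) (auto simp: sets_restrict_space)
  have rectL: "B \<times> {A} \<in> sets (?L \<Otimes>\<^sub>M ?C)"
    using B A by (intro pair_measureI) (auto simp: sets_restrict_space)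
  have eq: "{\<omega> \<in> space M. X \<omega> \<in> B \<and> l \<omega> = A} = {\<omega> \<in> space M. (X \<omega>, l \<omega>) \<in> B \<times> {A}}"
    by auto
  have "(\<lambda>\<omega>. (X \<omega>, l \<omega>)) \<in> M \<rightarrow>\<^sub>M ?R"
    using dens by (simp add: has_pair_density_def)
  from measurable_sets[OF this rect]
  show "{\<omega> \<in> space M. X \<omega> \<in> B \<and> l \<omega> = A} \<in> sets M"
    unfolding eq by (simp add: vimage_def Int_def conj_commute)
  have p [measurable]: "p \<in> borel_measurable (?L \<Otimes>\<^sub>M ?C)"
    using dens by (simp add: has_pair_density_def)
  note rectL [measurable]
  have nonneg: "0 \<le> p (x, A)" if "x \<in> unit_ball" for x
    using dens A that by (simp add: has_pair_density_def)
  have g_nonneg: "0 \<le> ?g x" for x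
    using nonneg pos by (simp add: cond_density_def)
  have pg: "p (x, A) = ?P * ?g x" if "x \<in> B" for x
    using that B pos by (auto simp: cond_density_def)
  \<comment> \<open>Tonelli needs a sigma-finite second factor; finiteness of \<open>Labels\<close>
    provides it.\<close>
  interpret sigma_finite_measure ?C
    using fin by (rule sigma_finite_measure_count_space_finite)
  have inner: "(\<integral>\<^sup>+ y. ennreal (p (x, y)) * indicator (B \<times> {A}) (x, y) \<partial>?C)
      = ennreal (p (x, A)) * indicator B x" for x
  proof -
    have "(\<integral>\<^sup>+ y. ennreal (p (x, y)) * indicator (B \<times> {A}) (x, y) \<partial>?C)
        = (\<Sum>y\<in>Labels. if y = A then ennreal (p (x, A)) * indicator B x else 0)"
      unfolding nn_integral_count_space_finite[OF fin]
      by (intro sum.cong) (auto simp: indicator_def)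
    then show ?thesis
      using fin A by simp
  qed
  have "emeasure M {\<omega> \<in> space M. X \<omega> \<in> B \<and> l \<omega> = A}
      = (\<integral>\<^sup>+ z \<in> B \<times> {A}. ennreal (p z) \<partial>(?L \<Otimes>\<^sub>M ?C))"
    unfolding eq using dens rect unfolding has_pair_density_def by blast
  also have "\<dots> = (\<integral>\<^sup>+ x. \<integral>\<^sup>+ y. ennreal (p (x, y)) * indicator (B \<times> {A}) (x, y) \<partial>?C \<partial>?L)"
    by (rule nn_integral_fst[symmetric]) measurable
  also have "\<dots> = (\<integral>\<^sup>+ x. ennreal (p (x, A)) * indicator B x \<partial>?L)"
    by (simp add: inner)
  also have "\<dots> = (\<integral>\<^sup>+ x. ennreal (p (x, A)) * indicator B x * indicator unit_ball x \<partial>lebesgue)"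
    by (rule nn_integral_restrict_space) simp
  \<comment> \<open>The indicator of \<open>unit_ball\<close> is absorbed because \<open>B\<close>
    lies in the ball.\<close>
  also have "\<dots> = (\<integral>\<^sup>+ x. ennreal (?P * (indicator B x *\<^sub>R ?g x)) \<partial>lebesgue)"
    using B pg by (intro nn_integral_cong) (auto simp: indicator_def)
  \<comment> \<open>Integrability is essential here: without it the Bochner integral would default
    to 0.\<close>
  also have "\<dots> = ennreal (LINT x|lebesgue. ?P * (indicator B x *\<^sub>R ?g x))"
    using int pos g_nonneg
    by (intro nn_integral_eq_integral) (auto simp: set_integrable_def)
  also have "(LINT x|lebesgue. ?P * (indicator B x *\<^sub>R ?g x)) = ?P * (LINT x:B|lebesgue. ?g x)"
    by (simp add: set_lebesgue_integral_def)
  finally show "measure M {\<omega> \<in> space M. X \<omega> \<in> B \<and> l \<omega> = A} = ?P * (LINT x:B|lebesgue. ?g x)"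
    using pos g_nonneg
    by (simp add: measure_def set_lebesgue_integral_def)
qed

theorem theorem1:
  fixes M :: "'w measure"
    and X :: "'w \<Rightarrow> real ^ 'n" and l :: "'w \<Rightarrow> real"
    and p :: "(real ^ 'n) \<times> real \<Rightarrow> real"
    and F :: "real ^ 'n \<Rightarrow> real"
    and Labels :: "real set" and A :: real
    and C\<^sub>A :: "(real ^ 'n) set" and x\<^sub>A :: "real ^ 'n"
    and r\<^sub>A C \<nu> \<Delta> :: real
  assumes "prob_space M"
    and "finite Labels"
    and "has_pair_density M Labels X l p"
    and "A \<in> Labels" and "label_prob p A > 0"
    and "C\<^sub>A \<in> sets lebesgue" and "C\<^sub>A \<subseteq> unit_ball"
    and "0 < r\<^sub>A" and "r\<^sub>A < 1"
    and "x\<^sub>A \<in> unit_ball"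
    and "C > 0" and "0 < \<nu>" and "\<nu> \<le> 1" and "\<Delta> > 0"
    and A1: "C\<^sub>A \<subseteq> cball x\<^sub>A r\<^sub>A"
    and A2a: "\<forall>x \<in> C\<^sub>A. F x = A"
    and A2b: "\<forall>x \<in> sphere x\<^sub>A r\<^sub>A. \<exists>y \<in> unit_ball. F y \<noteq> A \<and> norm (y - x) \<le> \<Delta>"
    and A3a: "\<forall>x \<in> cball x\<^sub>A r\<^sub>A. cond_density p A x
               \<le> C / measure lebesgue (unit_ball :: (real ^ 'n) set) * (1 / r\<^sub>A ^ CARD('n))"
    and A3b: "(LINT x:C\<^sub>A|lebesgue. cond_density p A x) \<ge> \<nu>"
  shows "\<forall>\<epsilon> \<in> {0 <..< r\<^sub>A}.
           prob_at_least M {\<omega> \<in> space M. admits_adversarial F (\<epsilon> + \<Delta>) (X \<omega>)}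
             (label_prob p A * max (\<nu> - C * (1 - \<epsilon> / r\<^sub>A) ^ CARD('n)) 0)"
proof
  fix \<epsilon> assume "\<epsilon> \<in> {0 <..< r\<^sub>A}"
  then have \<epsilon>: "0 < \<epsilon>" "\<epsilon> < r\<^sub>A" by auto
  let ?g = "cond_density p A" and ?V = "measure lebesgue (unit_ball :: (real ^ 'n) set)"
  define K where "K = C / ?V * (1 / r\<^sub>A ^ CARD('n))"
  \<comment> \<open>Removing an open ball leaves in \<open>D\<close> the points at distance exactly
    \<open>r\<^sub>A - \<epsilon>\<close>, as the non-strict hypothesis of
    \<open>sphere_point_near\<close> allows.\<close>
  define I where "I = C\<^sub>A \<inter> ball x\<^sub>A (r\<^sub>A - \<epsilon>)"
  define D where "D = C\<^sub>A - ball x\<^sub>A (r\<^sub>A - \<epsilon>)"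
  note [measurable] = \<open>C\<^sub>A \<in> sets lebesgue\<close>
  have I: "I \<in> sets lebesgue" and D: "D \<in> sets lebesgue"
    unfolding I_def D_def by auto
  have g_meas: "?g \<in> borel_measurable lebesgue"
    using assms by (intro measurable_cond_density)
  \<comment> \<open>A non-integrable function has Bochner integral 0 by convention, so the positive
    lower bound \<open>\<nu>\<close> forces integrability.\<close>
  have int: "set_integrable lebesgue C\<^sub>A ?g"
  proof (rule ccontr)
    assume "\<not> set_integrable lebesgue C\<^sub>A ?g"
    then have "(LINT x:C\<^sub>A|lebesgue. ?g x) = 0"
      by (simp add: set_integrable_def set_lebesgue_integral_def not_integrable_integral_eq)
    with A3b \<open>0 < \<nu>\<close> show False by simp
  qed
  have intI: "set_integrable lebesgue I ?g" and intD: "set_integrable lebesgue D ?g"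
    using int I D by (auto intro: set_integrable_subset simp: I_def D_def)
  have V: "?V = unit_ball_vol (real CARD('n))" "0 < ?V"
    by (simp_all add: content_cball)
  have "I \<subseteq> ball x\<^sub>A (r\<^sub>A - \<epsilon>)"
    by (simp add: I_def)
  moreover have ball: "ball x\<^sub>A (r\<^sub>A - \<epsilon>) \<in> lmeasurable"
    by simp
  ultimately have I_fm: "I \<in> lmeasurable"
    using I by (metis fmeasurableI2)
  have "(LINT x:I|lebesgue. ?g x) \<le> K * measure lebesgue I"
    using intI I_fm A3a A1 unfolding K_def by (intro set_integral_le_const_measure) (auto simp: I_def)
  also have "\<dots> \<le> K * measure lebesgue (ball x\<^sub>A (r\<^sub>A - \<epsilon>))"
    using \<open>C > 0\<close> \<open>0 < r\<^sub>A\<close> V(2) \<open>I \<subseteq> _\<close> I ball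
    by (intro mult_left_mono measure_mono_fmeasurable) (auto simp: K_def)
  also have "\<dots> = K * (?V * (r\<^sub>A - \<epsilon>) ^ CARD('n))"
    using \<epsilon> V(1) by (simp add: content_ball)
  \<comment> \<open>The volume of the unit ball in the denominator of \<open>K\<close> cancels the
    one from scaling, leaving only the ratio of the radii.\<close>
  also have "\<dots> = C * ((r\<^sub>A - \<epsilon>) / r\<^sub>A) ^ CARD('n)"
    using V(2) by (simp add: K_def power_divide)
  also have "(r\<^sub>A - \<epsilon>) / r\<^sub>A = 1 - \<epsilon> / r\<^sub>A"
    using \<open>0 < r\<^sub>A\<close> by (simp add: field_simps)
  finally have inner: "(LINT x:I|lebesgue. ?g x) \<le> C * (1 - \<epsilon> / r\<^sub>A) ^ CARD('n)" .
  have "C\<^sub>A = I \<union> D" "I \<inter> D = {}"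
    by (auto simp: I_def D_def)
  then have "(LINT x:C\<^sub>A|lebesgue. ?g x) = (LINT x:I|lebesgue. ?g x) + (LINT x:D|lebesgue. ?g x)"
    using set_integral_Un[OF _ intI intD] by simp
  with inner A3b have outer: "\<nu> - C * (1 - \<epsilon> / r\<^sub>A) ^ CARD('n) \<le> (LINT x:D|lebesgue. ?g x)"
    by simp
  \<comment> \<open>From here on \<open>B\<close> replaces \<open>D\<close>: the integral of the
    conditional density is the same, and \<open>X\<close> landing in \<open>B\<close> is a
    measurable condition.\<close>
  obtain B where B: "B \<in> sets borel" "B \<subseteq> D" "AE x in lebesgue. x \<in> B \<longleftrightarrow> x \<in> D"
    using D by (rule borel_subset_lebesgue)
  have B_leb: "B \<in> sets lebesgue"
    using B(1) by auto
  have intB: "set_integrable lebesgue B ?g"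
    using intD B_leb B(2) by (rule set_integrable_subset)
  have "(LINT x:D|lebesgue. ?g x) = (LINT x:B|lebesgue. ?g x)"
    using intB intD B(3)
    by (intro set_integral_cong_set) (auto simp: set_integrable_def set_borel_measurable_def)
  \<comment> \<open>The adversarial event puts no condition on the label. Requiring
    \<open>l \<omega> = A\<close> only shrinks it, and turns the conditional bound into a
    probability with the factor \<open>label_prob p A\<close>.\<close>
  define E where "E = {\<omega> \<in> space M. X \<omega> \<in> B \<and> l \<omega> = A}"
  have B_ball: "B \<subseteq> unit_ball"
    using B(2) \<open>C\<^sub>A \<subseteq> unit_ball\<close> by (auto simp: D_def)
  note event = measure_label_event[OF assms(3,2,4,5) B(1) B_ball intB, folded E_def]
  have "label_prob p A * (\<nu> - C * (1 - \<epsilon> / r\<^sub>A) ^ CARD('n)) \<le> measure M E"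
    using outer \<open>label_prob p A > 0\<close> unfolding event(2) \<open>(LINT x:D|lebesgue. ?g x) = _\<close> by simp
  \<comment> \<open>If the difference is negative, the maximum is 0 and nonnegativity of the measure
    suffices.\<close>
  then have bound: "label_prob p A * max (\<nu> - C * (1 - \<epsilon> / r\<^sub>A) ^ CARD('n)) 0 \<le> measure M E"
    by (simp add: max_def)
  have adv: "admits_adversarial F (\<epsilon> + \<Delta>) x" if "x \<in> B" for x
  proof -
    have x: "x \<in> C\<^sub>A" "r\<^sub>A - \<epsilon> \<le> dist x\<^sub>A x"
      using that B(2) by (auto simp: D_def)
    then obtain s where s: "s \<in> sphere x\<^sub>A r\<^sub>A" "dist x s \<le> \<epsilon>"
      using sphere_point_near[of x\<^sub>A x r\<^sub>A \<epsilon>] A1 \<epsilon>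
      by (meson less_imp_le mem_cball order_less_trans subsetD)
    then obtain y where y: "y \<in> unit_ball" "F y \<noteq> A" "norm (y - s) \<le> \<Delta>"
      using A2b by blast
    have "norm (x - y) \<le> \<epsilon> + \<Delta>"
      using s(2) y(3) dist_triangle_le[of x s y "\<epsilon> + \<Delta>"] by (simp add: dist_norm norm_minus_commute)
    then show ?thesis
      using y x(1) A2a unfolding admits_adversarial_def by metis
  qed
  then have "E \<subseteq> {\<omega> \<in> space M. admits_adversarial F (\<epsilon> + \<Delta>) (X \<omega>)}"
    by (auto simp: E_def)
  with bound event(1) show "prob_at_least M {\<omega> \<in> space M. admits_adversarial F (\<epsilon> + \<Delta>) (X \<omega>)}
      (label_prob p A * max (\<nu> - C * (1 - \<epsilon> / r\<^sub>A) ^ CARD('n)) 0)"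
    unfolding prob_at_least_def by blast
qed

end
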